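(* Let $n_s\neq n_t$ be nodes, let $\rho^{FS}$ be a fastest simplest route in the road network from $n_s$ to $n_t$, and let $\rho_{\mathcal{E}}^{FS*}$ be its special expanded route. Then there is no expanded route that starts at $(n_s,r_i)$ and ends at $(n_t,r_j)$, for any $r_i\in R(n_s)$ and $r_j\in R(n_t)$, which is FS-shorter than $\rho_{\mathcal{E}}^{FS*}$.
   Context: Let $V$ be a finite set of nodes. A road is a finite sequence of distinct nodes of $V$. Let $R$ be a finite set of roads such that every node lies on at least one road and any pair of consecutive nodes of some road does not appear (as consecutive nodes) in any other road. For $n\in V$, $R(n)$ is the set of roads containing $n$. The road network $G_R=(V,E)$ is the directed graph with an edge $(n_i,n_j)$ whenever $n_i,n_j$ are consecutive nodes of some road; $R(n_i,n_j)$ denotes the unique road containing this segment. A length function $L:E\to\mathbb{R}^+$ is given. The turn cost is $C(n,r,r')=1$ if $r\neq r'$ and $C(n,r,r)=0$ ($r,r'\in R(n)$). A route is a sequence of nodes $\rho=(n_1,\dots,n_k)$ with $(n_m,n_{m+1})\in E$; its length is $L(\rho)=\sum_{m=1}^{k-1}L(n_m,n_{m+1})$ and its complexity is $C(\rho)=\sum_{m=2}^{k-1}C(n_m,R(n_{m-1},n_m),R(n_m,n_{m+1}))$. A simplest route from $n_s$ to $n_t$ is one of minimum complexity among routes from $n_s$ to $n_t$; a fastest simplest route is one of minimum length among all simplest routes from $n_s$ to $n_t$. The expanded graph $G_{\mathcal{E}}$ has expanded nodes $(n,r)$ with $r\in R(n)$ and an edge $((n_x,r_i),(n_y,r_j))$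 whenever $r_i,r_j\in R(n_x)$ ($r_i=r_j$ allowed) and $n_x,n_y$ are consecutive nodes of $r_j$. An expanded route $((n_1,r_1),\dots,(n_k,r_k))$ is a path in $G_{\mathcal{E}}$, with length $\sum_{m=1}^{k-1}L(n_m,n_{m+1})$ and complexity $\sum_{m=1}^{k-1}C(n_m,r_m,r_{m+1})$. For a route $\rho=(n_1,\dots,n_k)$, $k\ge2$, its special expanded route is $((n_1,R(n_1,n_2)),(n_2,R(n_1,n_2)),(n_3,R(n_2,n_3)),\dots,(n_k,R(n_{k-1},n_k)))$. For two (expanded) routes, $\rho^1$ is FS-shorter than $\rho^2$ if $C(\rho^1)<C(\rho^2)$, or $C(\rho^1)=C(\rho^2)$ and $L(\rho^1)<L(\rho^2)$. *)

theory Defs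
  imports Complex_Main "Graph_Theory.Pair_Digraph" "Graph_Theory.Vertex_Walk"
begin

type_synonym 'v road = "'v list"

text \<open>
  Roads are directed: \<open>x\<close> and \<open>y\<close> are consecutive on \<open>r\<close> if \<open>y\<close> immediately follows \<open>x\<close>.
\<close>

definition consecutive :: "'v road \<Rightarrow> 'v \<Rightarrow> 'v \<Rightarrow> bool" where
  "consecutive r x y \<longleftrightarrow> (x, y) \<in> set (vwalk_arcs r)"

definition road_graph :: "'v set \<Rightarrow> 'v road set \<Rightarrow> 'v pair_pre_digraph" where
  "road_graph V R = \<lparr> pverts = V, parcs = {(x, y). \<exists>r\<in>R. consecutive r x y} \<rparr>"

locale road_network =
  fixes V :: "'v set" and R :: "'v road set" and L :: "'v \<Rightarrow> 'v \<Rightarrow> real"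
  assumes finite_nodes: "finite V"
    and finite_roads: "finite R"
    and road_nodes: "r \<in> R \<Longrightarrow> set r \<subseteq> V"
    and road_distinct: "r \<in> R \<Longrightarrow> distinct r"
    and node_on_road: "n \<in> V \<Longrightarrow> \<exists>r\<in>R. n \<in> set r"
    and segment_unique:
      "\<lbrakk>r \<in> R; r' \<in> R; consecutive r x y; consecutive r' x y\<rbrakk> \<Longrightarrow> r = r'"
    and length_pos: "(x, y) \<in> parcs (road_graph V R) \<Longrightarrow> 0 < L x y"

definition roads_at :: "'v road set \<Rightarrow> 'v \<Rightarrow> 'v road set" where
  "roads_at R n = {r \<in> R. n \<in> set r}"

definition road_of :: "'v road set \<Rightarrow> 'v \<Rightarrow> 'v \<Rightarrow> 'v road" where
  "road_of R x y = (THE r. r \<in> R \<and> consecutive r x y)"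

definition turn_cost :: "'v \<Rightarrow> 'v road \<Rightarrow> 'v road \<Rightarrow> nat" where
  "turn_cost n r r' = (if r = r' then 0 else 1)"

text \<open>
  Positions in the (expanded) routes below are counted from \<open>0\<close>.
\<close>

definition route_length :: "('v \<Rightarrow> 'v \<Rightarrow> real) \<Rightarrow> 'v list \<Rightarrow> real" where
  "route_length L p = (\<Sum>m<length p - 1. L (p ! m) (p ! Suc m))"

definition route_complexity :: "'v road set \<Rightarrow> 'v list \<Rightarrow> nat" where
  "route_complexity R p =
     (\<Sum>m\<in>{1..<length p - 1}.
        turn_cost (p ! m) (road_of R (p ! (m - 1)) (p ! m)) (road_of R (p ! m) (p ! Suc m)))"

definition route_between :: "'v set \<Rightarrow> 'v road set \<Rightarrow> 'v \<Rightarrow> 'v \<Rightarrow> 'v list \<Rightarrow> bool" where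
  "route_between V R s t p \<longleftrightarrow> vwalk p (with_proj (road_graph V R)) \<and> hd p = s \<and> last p = t"

definition simplest_route :: "'v set \<Rightarrow> 'v road set \<Rightarrow> 'v \<Rightarrow> 'v \<Rightarrow> 'v list \<Rightarrow> bool" where
  "simplest_route V R s t = is_arg_min (route_complexity R) (route_between V R s t)"

definition fastest_simplest_route ::
  "'v set \<Rightarrow> 'v road set \<Rightarrow> ('v \<Rightarrow> 'v \<Rightarrow> real) \<Rightarrow> 'v \<Rightarrow> 'v \<Rightarrow> 'v list \<Rightarrow> bool" where
  "fastest_simplest_route V R L s t = is_arg_min (route_length L) (simplest_route V R s t)"

definition expanded_graph :: "'v set \<Rightarrow> 'v road set \<Rightarrow> ('v \<times> 'v road) pair_pre_digraph" where
  "expanded_graph V R =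
     \<lparr> pverts = {(n, r). n \<in> V \<and> r \<in> roads_at R n},
       parcs = {((x, r), (y, r')). r \<in> roads_at R x \<and> r' \<in> roads_at R x \<and> consecutive r' x y} \<rparr>"

definition expanded_route :: "'v set \<Rightarrow> 'v road set \<Rightarrow> ('v \<times> 'v road) list \<Rightarrow> bool" where
  "expanded_route V R q \<longleftrightarrow> vwalk q (with_proj (expanded_graph V R))"

definition expanded_length :: "('v \<Rightarrow> 'v \<Rightarrow> real) \<Rightarrow> ('v \<times> 'v road) list \<Rightarrow> real" where
  "expanded_length L q = (\<Sum>m<length q - 1. L (fst (q ! m)) (fst (q ! Suc m)))"

definition expanded_complexity :: "('v \<times> 'v road) list \<Rightarrow> nat" where
  "expanded_complexity q =
     (\<Sum>m<length q - 1. turn_cost (fst (q ! m)) (snd (q ! m)) (snd (q ! Suc m)))"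

text \<open>
  Only meaningful for routes with at least two nodes.
\<close>

definition special_expanded_route :: "'v road set \<Rightarrow> 'v list \<Rightarrow> ('v \<times> 'v road) list" where
  "special_expanded_route R p =
     (p ! 0, road_of R (p ! 0) (p ! 1)) #
     map (\<lambda>m. (p ! Suc m, road_of R (p ! m) (p ! Suc m))) [0..<length p - 1]"

definition FS_shorter :: "('p \<Rightarrow> nat) \<Rightarrow> ('p \<Rightarrow> real) \<Rightarrow> 'p \<Rightarrow> 'p \<Rightarrow> bool" where
  "FS_shorter C L p q \<longleftrightarrow> C p < C q \<or> (C p = C q \<and> L p < L q)"

end

theory Submission
  imports Defs
begin

text \<open>
  Every expanded node after the first carries the road of the segment just traversed. Hence the
  complexity of an expanded route is that of its projection to the road network plus the cost of
  the initial turn at the start node, and this initial cost vanishes for special expanded routes.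
  Lengths are unaffected by projecting, so an FS-shorter expanded route would project to a route
  beating the fastest simplest one.
\<close>

lemma vwalk_arcs_nth: "Suc m < length p \<Longrightarrow> vwalk_arcs p ! m = (p ! m, p ! Suc m)"
proof (induction p arbitrary: m rule: vwalk_arcs.induct)
  case (3 x y xs)
  then show ?case by (cases m) simp_all
qed simp_all

text \<open>Bridges the recursively defined arc lists of walks and the position-indexed sums in
  which length and complexity are defined.\<close>

lemma set_vwalk_arcs_conv_nth: "set (vwalk_arcs p) = {(p ! m, p ! Suc m) | m. Suc m < length p}"
proof -
  have len: "length (vwalk_arcs p) = length p - 1"
    using vwalk_length_simp by (simp only: vwalk_length_def)
  show ?thesis
    unfolding set_conv_nth len less_diff_conv by (force simp: vwalk_arcs_nth)
qed

lemma vwalk_nth_arc: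
  assumes "vwalk p G" "Suc m < length p"
  shows "(p ! m, p ! Suc m) \<in> arcs_ends G"
  using assms unfolding vwalk_def set_vwalk_arcs_conv_nth by blast

text \<open>Segment uniqueness is what makes the \<open>THE\<close> in \<open>road_of\<close>
  denote.\<close>

lemma road_of_eqI:
  assumes "road_network V R L" "r \<in> R" "consecutive r x y"
  shows "road_of R x y = r"
  unfolding road_of_def using assms road_network.segment_unique by (metis (mono_tags, lifting) the_equality)

lemma expanded_route_step:
  assumes "expanded_route V R q" "Suc m < length q"
  shows "snd (q ! Suc m) \<in> R"
    and "consecutive (snd (q ! Suc m)) (fst (q ! m)) (fst (q ! Suc m))"
  using vwalk_nth_arc[OF assms(1)[unfolded expanded_route_def] assms(2)]
  by (auto simp: expanded_graph_def roads_at_def)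

lemma expanded_route_projection:
  assumes q: "expanded_route V R q"
  shows "vwalk (map fst q) (with_proj (road_graph V R))"
proof -
  have walk: "vwalk q (with_proj (expanded_graph V R))"
    using q by (simp add: expanded_route_def)
  have "set (map fst q) \<subseteq> V"
    using walk by (auto simp: vwalk_def expanded_graph_def)
  moreover have "set (vwalk_arcs (map fst q)) \<subseteq> parcs (road_graph V R)"
    using expanded_route_step[OF q]
    by (fastforce simp: set_vwalk_arcs_conv_nth road_graph_def)
  ultimately show ?thesis
    using walk by (auto simp: vwalk_def road_graph_def)
qed

lemma expanded_length_eq_route_length: "expanded_length L q = route_length L (map fst q)"
  unfolding expanded_length_def route_length_def by (intro sum.cong) auto

text \<open>The labelling is assumed through \<open>road_of\<close>, not through
  \<open>expanded_route\<close>, so that the same formula serves arbitrary expanded routes and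
  special ones, the latter without a proof that they are walks.\<close>

lemma expanded_complexity_eq_initial_plus_route_complexity:
  assumes roads: "\<And>m. Suc m < length q \<Longrightarrow> snd (q ! Suc m) = road_of R (fst (q ! m)) (fst (q ! Suc m))"
    and len: "2 \<le> length q"
  shows "expanded_complexity q =
    turn_cost (fst (q ! 0)) (snd (q ! 0)) (snd (q ! 1)) + route_complexity R (map fst q)"
proof -
  let ?f = "\<lambda>m. turn_cost (fst (q ! m)) (snd (q ! m)) (snd (q ! Suc m))"
  have "expanded_complexity q = ?f 0 + (\<Sum>m\<in>{1..<length q - 1}. ?f m)"
    unfolding expanded_complexity_def lessThan_atLeast0
    using len by (subst sum.atLeast_Suc_lessThan) auto
  also have "(\<Sum>m\<in>{1..<length q - 1}. ?f m) = route_complexity R (map fst q)"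
    unfolding route_complexity_def
  proof (intro sum.cong)
    \<comment> \<open>Since \<open>m\<close> has a predecessor, the label of node \<open>m\<close>
      is itself the road of the segment entering it; only position 0 has a free label.\<close>
    fix m assume "m \<in> {1..<length (map fst q) - 1}"
    then obtain k where "m = Suc k" "Suc (Suc k) < length q"
      by (cases m) auto
    then show "?f m = turn_cost (map fst q ! m)
        (road_of R (map fst q ! (m - 1)) (map fst q ! m))
        (road_of R (map fst q ! m) (map fst q ! Suc m))"
      by (simp add: roads)
  qed simp
  finally show ?thesis by simp
qed

text \<open>The difference is the initial turn cost, a natural number. With fewer than two nodes the
  sum for the projection is empty.\<close>

lemma route_complexity_projection_le:
  assumes net: "road_network V R L" and q: "expanded_route V R q"
  shows "route_complexity R (map fst q) \<le> expanded_complexity q"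
proof (cases "2 \<le> length q")
  case True
  then show ?thesis
    using expanded_complexity_eq_initial_plus_route_complexity[of q R]
      road_of_eqI[OF net expanded_route_step[OF q]] by simp
qed (simp add: route_complexity_def)

lemma map_fst_special_expanded_route:
  assumes "p \<noteq> []"
  shows "map fst (special_expanded_route R p) = p"
  using assms unfolding special_expanded_route_def
  by (cases p) (auto intro!: nth_equalityI simp: nth_Cons split: nat.split)

lemma expanded_complexity_special:
  assumes "2 \<le> length p"
  shows "expanded_complexity (special_expanded_route R p) = route_complexity R p"
proof -
  let ?q = "special_expanded_route R p"
  have p: "map fst ?q = p"
    using assms by (intro map_fst_special_expanded_route) auto
  have len: "length ?q = length p"
    using p by (metis length_map)
  have fst_nth: "fst (?q ! m) = p ! m" if "m < length p" for m
    using that p len by (metis nth_map)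
  have roads: "snd (?q ! Suc m) = road_of R (p ! m) (p ! Suc m)" if "Suc m < length p" for m
    using that by (simp add: special_expanded_route_def less_diff_conv)
  \<comment> \<open>Both labels are the road of the first segment, so the initial turn is
    free.\<close>
  have "snd (?q ! 0) = snd (?q ! 1)"
    using assms roads[of 0] by (simp add: special_expanded_route_def)
  then show ?thesis
    using expanded_complexity_eq_initial_plus_route_complexity[of ?q R] assms
    by (simp add: p len fst_nth roads turn_cost_def)
qed

theorem theorem1:
  fixes V :: "'v set" and R :: "'v road set" and L :: "'v \<Rightarrow> 'v \<Rightarrow> real"
    and s t :: 'v and p :: "'v list"
  assumes "road_network V R L"
    and "s \<in> V" and "t \<in> V" and "s \<noteq> t"
    and "fastest_simplest_route V R L s t p"
  shows "\<not> (\<exists>r\<in>roads_at R s. \<exists>r'\<in>roads_at R t. \<exists>q.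
            expanded_route V R q \<and> hd q = (s, r) \<and> last q = (t, r') \<and>
            FS_shorter expanded_complexity (expanded_length L) q (special_expanded_route R p))"
proof clarify
  fix r r' q
  assume q: "expanded_route V R q" "hd q = (s, r)" "last q = (t, r')"
    and shorter: "FS_shorter expanded_complexity (expanded_length L) q (special_expanded_route R p)"
  have p: "route_between V R s t p"
    and simplest: "\<And>p'. route_between V R s t p' \<Longrightarrow> route_complexity R p \<le> route_complexity R p'"
    and fastest: "\<And>p'. simplest_route V R s t p' \<Longrightarrow> route_length L p \<le> route_length L p'"
    using assms(5) unfolding fastest_simplest_route_def simplest_route_def is_arg_min_linorder
    by blast+
  \<comment> \<open>A one-node walk would force \<open>s = t\<close>.\<close>
  have len: "2 \<le> length p"
    using p \<open>s \<noteq> t\<close> unfolding route_between_def vwalk_def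
    by (cases p rule: vwalk_arcs.cases) auto
  then have "p \<noteq> []" by auto
  then have special: "expanded_complexity (special_expanded_route R p) = route_complexity R p"
    "expanded_length L (special_expanded_route R p) = route_length L p"
    using len by (simp_all add: expanded_complexity_special expanded_length_eq_route_length
        map_fst_special_expanded_route)
  let ?p' = "map fst q"
  have "q \<noteq> []"
    using q(1) by (auto simp: expanded_route_def vwalk_def)
  then have p': "route_between V R s t ?p'"
    using q expanded_route_projection[OF q(1)]
    by (simp add: route_between_def hd_map last_map)
  have le: "route_complexity R p \<le> route_complexity R ?p'"
    "route_complexity R ?p' \<le> expanded_complexity q"
    using simplest[OF p'] route_complexity_projection_le[OF assms(1) q(1)] .
  \<comment> \<open>FS-shortness bounds \<open>expanded_complexity q\<close> by
    \<open>route_complexity R p\<close>, which closes the chain \<open>le\<close> into equalities. A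
    strict gain in complexity is thus impossible, and the gain must be in length.\<close>
  then have eq: "route_complexity R ?p' = route_complexity R p"
    and shorter_length: "route_length L ?p' < route_length L p"
    using shorter unfolding FS_shorter_def special expanded_length_eq_route_length[of L q] by auto
  \<comment> \<open>Equal complexity makes the projection a competitor of \<open>p\<close> in the
    second minimisation.\<close>
  have "simplest_route V R s t ?p'"
    using p' simplest unfolding simplest_route_def is_arg_min_linorder eq by blast
  then show False
    using fastest shorter_length by fastforce
qed

end
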